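(* There exists a linear map $T:\mathbb{R}^2\to\mathbb{R}^2$, $Tx=Ax$, induced by a real matrix $A=\begin{pmatrix}a_{11}&a_{12}\\ a_{21}&a_{22}\end{pmatrix}$, such that $T$ is weakly transitive in weak topology and has a fixed point, but $T$ is not weakly Li–Yorke chaotic in weak topology.
   Context: Let $\mathbb{N}=\{1,2,3,\dots\}$. Continuous linear functionals on $\mathbb{R}^2$ are identified with vectors $x^*\in\mathbb{R}^2$ via $\langle x,x^*\rangle=x_1x_1^*+x_2x_2^*$, and $p_{x^*}(x)=|\langle x,x^*\rangle|$. A fixed point of $T$ is a point $x$ with $Tx=x$. $T$ is weakly transitive in weak topology if there is a nonzero $x^*$ such that for all $x,y\in\mathbb{R}^2$ and $\varepsilon>0$ there exist $n\in\mathbb{N}$, $z\in\mathbb{R}^2$ with $p_{x^*}(z-x)<\varepsilon$ and $p_{x^*}(T^nz-y)<\varepsilon$. $T$ is weakly Li–Yorke chaotic in weak topology if there are a nonzero $x^*$ and an uncountable set $S\subset\mathbb{R}^2$ such that for all distinct $x,y\in S$: $\liminf_{k\to\infty}p_{x^*}(T^kx-T^ky)=0$ and $\limsup_{k\to\infty}p_{x^*}(T^kx-T^ky)>0$. *)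

theory Defs
  imports "HOL-Analysis.Analysis"
begin

definition func_seminorm :: "real^2 \<Rightarrow> real^2 \<Rightarrow> real" where
  "func_seminorm xs x = \<bar>x \<bullet> xs\<bar>"

definition weakly_transitive_weak :: "(real^2 \<Rightarrow> real^2) \<Rightarrow> bool" where
  "weakly_transitive_weak T \<longleftrightarrow>
     (\<exists>xs. xs \<noteq> 0 \<and>
        (\<forall>x y. \<forall>\<epsilon>>0. \<exists>n\<ge>1. \<exists>z.
           func_seminorm xs (z - x) < \<epsilon> \<and> func_seminorm xs ((T ^^ n) z - y) < \<epsilon>))"

text \<open>The limits inferior and superior are taken in the extended reals, so that the upper
  limit of an unbounded sequence is infinite, hence positive.\<close>

definition weakly_Li_Yorke_chaotic_weak :: "(real^2 \<Rightarrow> real^2) \<Rightarrow> bool" where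
  "weakly_Li_Yorke_chaotic_weak T \<longleftrightarrow>
     (\<exists>xs S. xs \<noteq> 0 \<and> uncountable S \<and>
        (\<forall>x\<in>S. \<forall>y\<in>S. x \<noteq> y \<longrightarrow>
           liminf (\<lambda>k. ereal (func_seminorm xs ((T ^^ k) x - (T ^^ k) y))) = 0 \<and>
           limsup (\<lambda>k. ereal (func_seminorm xs ((T ^^ k) x - (T ^^ k) y))) > 0))"

end

theory Submission
  imports Defs
begin

text \<open>The witness is the shear \<open>(a, b) \<mapsto> (a + b, b)\<close>. Seen through the first coordinate,
  one step of the shear already moves any prescribed value to any other, because the second
  coordinate of the starting point is free; this is weak transitivity, and the origin is fixed.
  On the other hand the iterates of the shear are affine in the exponent, so under every
  functional the distance of two orbits has the form \<open>\<bar>c + k e\<bar>\<close>. Such a sequence either is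
  constant (\<open>e = 0\<close>) or tends to infinity, so its limits inferior and superior agree and no pair
  of distinct points can satisfy the Li--Yorke condition.\<close>

definition shear_matrix :: "real^2^2" where
  "shear_matrix = vector [vector [1, 1], vector [0, 1]]"

lemma shear_matrix_mult: "shear_matrix *v x = vector [x$1 + x$2, x$2]"
  by (simp add: shear_matrix_def vec_eq_iff forall_2 matrix_vector_mult_def sum_2)

lemma shear_matrix_funpow:
  "(((*v) shear_matrix) ^^ k) x = vector [x$1 + real k * x$2, x$2]"
proof (induction k)
  case 0
  show ?case by (simp add: vec_eq_iff forall_2)
next
  case (Suc k)
  then show ?case by (simp add: shear_matrix_mult vec_eq_iff forall_2 algebra_simps)
qed

lemma func_seminorm_shear_orbits:
  "func_seminorm xs ((((*v) shear_matrix) ^^ k) x - (((*v) shear_matrix) ^^ k) y)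
     = \<bar>(x - y) \<bullet> xs + real k * ((x$2 - y$2) * xs$1)\<bar>"
  by (simp add: func_seminorm_def shear_matrix_funpow inner_vec_def sum_2 algebra_simps)

text \<open>A constant sequence and a sequence tending to infinity both have a limit in the extended
  reals. This is what rules out Li--Yorke pairs.\<close>

lemma liminf_eq_limsup_abs_affine:
  fixes c e :: real
  shows "liminf (\<lambda>k. ereal \<bar>c + real k * e\<bar>) = limsup (\<lambda>k. ereal \<bar>c + real k * e\<bar>)"
proof (cases "e = 0")
  case True
  then show ?thesis by (simp add: Liminf_const Limsup_const)
next
  case False
  have "filterlim (\<lambda>k. norm (real k * e)) at_top sequentially"
    unfolding norm_mult
    by (rule filterlim_at_top_mult_tendsto_pos[where c = "\<bar>e\<bar>"])
       (use False in \<open>auto intro: filterlim_real_sequentially\<close>)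
  then have "filterlim (\<lambda>k. c + real k * e) at_infinity sequentially"
    by (intro tendsto_add_filterlim_at_infinity[OF tendsto_const])
       (rule filterlim_norm_at_top_imp_at_infinity)
  then have "filterlim (\<lambda>k. \<bar>c + real k * e\<bar>) at_top sequentially"
    using filterlim_at_infinity_imp_norm_at_top by force
  then have "(\<lambda>k. ereal \<bar>c + real k * e\<bar>) \<longlonglongrightarrow> \<infinity>"
    by (simp add: tendsto_PInfty_eq_at_top)
  then show ?thesis
    by (simp add: lim_imp_Liminf lim_imp_Limsup)
qed

lemma weakly_transitive_weak_shear: "weakly_transitive_weak ((*v) shear_matrix)"
  unfolding weakly_transitive_weak_def
proof (intro exI[of _ "axis 1 1 :: real^2"] conjI allI impI)
  show "axis 1 1 \<noteq> (0 :: real^2)" by simp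
next
  fix x y :: "real^2" and \<epsilon> :: real
  assume "\<epsilon> > 0"
  \<comment> \<open>The second coordinate is the increment that carries \<open>x$1\<close> to \<open>y$1\<close> in one step.\<close>
  define z :: "real^2" where "z = vector [x$1, y$1 - x$1]"
  have "func_seminorm (axis 1 1) (z - x) = 0"
    by (simp add: func_seminorm_def inner_axis z_def)
  moreover have "func_seminorm (axis 1 1) ((((*v) shear_matrix) ^^ 1) z - y) = 0"
    by (simp add: func_seminorm_def inner_axis z_def shear_matrix_mult)
  ultimately show "\<exists>n\<ge>1. \<exists>z. func_seminorm (axis 1 1) (z - x) < \<epsilon> \<and>
      func_seminorm (axis 1 1) ((((*v) shear_matrix) ^^ n) z - y) < \<epsilon>"
    using \<open>\<epsilon> > 0\<close> by (metis order_refl)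
qed

lemma not_weakly_Li_Yorke_chaotic_weak_shear:
  "\<not> weakly_Li_Yorke_chaotic_weak ((*v) shear_matrix)"
proof
  assume "weakly_Li_Yorke_chaotic_weak ((*v) shear_matrix)"
  then obtain xs :: "real^2" and S where "uncountable S" and
    chaos: "\<And>x y. x \<in> S \<Longrightarrow> y \<in> S \<Longrightarrow> x \<noteq> y \<Longrightarrow>
      liminf (\<lambda>k. ereal (func_seminorm xs
        ((((*v) shear_matrix) ^^ k) x - (((*v) shear_matrix) ^^ k) y))) = 0 \<and>
      limsup (\<lambda>k. ereal (func_seminorm xs
        ((((*v) shear_matrix) ^^ k) x - (((*v) shear_matrix) ^^ k) y))) > 0"
    unfolding weakly_Li_Yorke_chaotic_weak_def by blast
  obtain x y where "x \<in> S" "y \<in> S" "x \<noteq> y"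
    using \<open>uncountable S\<close> uncountable_infinite infinite_imp_nonempty
    by (metis countable_empty countable_insert subsetI subset_singletonD singletonI ex_in_conv)
  from chaos[OF this] show False
    unfolding func_seminorm_shear_orbits liminf_eq_limsup_abs_affine by (metis less_irrefl)
qed

theorem theorem6p5:
  "\<exists>(T :: real^2 \<Rightarrow> real^2) (A :: real^2^2).
     linear T \<and> (\<forall>x. T x = A *v x) \<and>
     weakly_transitive_weak T \<and> (\<exists>x. T x = x) \<and>
     \<not> weakly_Li_Yorke_chaotic_weak T"
proof (intro exI conjI)
  show "linear ((*v) shear_matrix)" by (rule matrix_vector_mul_linear)
  show "\<forall>x. shear_matrix *v x = shear_matrix *v x" by simp
  show "weakly_transitive_weak ((*v) shear_matrix)" by (rule weakly_transitive_weak_shear)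
  show "shear_matrix *v 0 = 0" by simp
  show "\<not> weakly_Li_Yorke_chaotic_weak ((*v) shear_matrix)"
    by (rule not_weakly_Li_Yorke_chaotic_weak_shear)
qed

end
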